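(* For every integer $m\ge 2$ define $$E(m)=\frac{3}{2m+1}-\sum_{i=0}^{m-1}\frac{(2m-2i-2)!}{2^{2m-2i-2}\,(2i+1)\,(m-i-1)!\,(m-i)!}.$$ Then for every real $x\in(0,1]$ and every positive integer $k$, $$\frac{3x+\sum_{m=2}^{2k+1}(-1)^m E(m)\,x^{2m+1}}{1+2\sqrt{1+x^2}}<\arctan x<\frac{3x+\sum_{m=2}^{2k}(-1)^m E(m)\,x^{2m+1}}{1+2\sqrt{1+x^2}}.$$ *)

theory Defs
  imports Complex_Main
begin

text \<open>
  Since \<open>i < m\<close> in every summand, none of the subtractions on natural numbers truncates.
  Only the values for \<open>m \<ge> 2\<close> are ever used.
\<close>

definition E :: "nat \<Rightarrow> real" where
  "E m = 3 / (2 * real m + 1) -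
     (\<Sum>i<m. fact (2 * m - 2 * i - 2) /
        (2 ^ (2 * m - 2 * i - 2) * (2 * real i + 1) * fact (m - i - 1) * fact (m - i)))"

end

theory Submission
  imports Defs "HOL-Analysis.Analysis"
begin

text \<open>
  The numbers \<open>(-1)\<^sup>m E(m)\<close> are the Taylor coefficients of
  \<open>(1 + 2 \<surd>(1 + x\<^sup>2)) arctan x\<close>, with \<open>E(0) = 3\<close> and \<open>E(1) = 0\<close>. The numbers
  \<open>w(m) = 1 - (2m+1) E(m)\<close> satisfy a first-order recurrence whose inhomogeneous term \<open>q(m)\<close> is
  explicit. It yields \<open>w(m) \<ge> 4/3 q(m)\<close>, hence that \<open>E(m)\<close> decreases from \<open>m = 4\<close> on, so the
  Leibniz argument applies to all remainders but the one after \<open>m = 2\<close>, where four consecutive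
  terms have to be grouped together. The endpoint \<open>x = 1\<close> follows by continuity.
\<close>

section \<open>Coefficients of the square root and of its product with the arctangent\<close>

text \<open>The coefficient of t^j in 2 sqrt(1 - t): the alternating sign of the expansion of 2
  sqrt(1 + x^2) is stripped off.\<close>

definition sqrt_coeff :: "nat \<Rightarrow> real" where
  "sqrt_coeff j = 2 * (-1) ^ j * ((1/2) gchoose j)"

lemma sqrt_coeff_0 [simp]: "sqrt_coeff 0 = 2"
  by (simp add: sqrt_coeff_def)

lemma sqrt_coeff_Suc: "2 * (real j + 1) * sqrt_coeff (Suc j) = (2 * real j - 1) * sqrt_coeff j"
proof -
  have "(real j + 1) * ((1/2::real) gchoose Suc j) = (1/2 - real j) * ((1/2) gchoose j)"
    using gbinomial_absorb_comp[of "1/2::real" j] gbinomial_absorption[of j "1/2::real"]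
    by (simp add: algebra_simps)
  moreover have "2 * (real j + 1) * sqrt_coeff (Suc j)
      = - 4 * (-1) ^ j * ((real j + 1) * ((1/2) gchoose Suc j))"
    by (simp add: sqrt_coeff_def)
  ultimately have "2 * (real j + 1) * sqrt_coeff (Suc j)
      = - 4 * (-1) ^ j * ((1/2 - real j) * ((1/2) gchoose j))"
    by simp
  also have "\<dots> = (2 * real j - 1) * sqrt_coeff j"
    by (simp add: sqrt_coeff_def algebra_simps)
  finally show ?thesis .
qed

text \<open>Up to sign these are Catalan numbers divided by 4^j, which is how the coefficients enter
  \<open>E\<close>, with j = m - i - 1.\<close>

lemma sqrt_coeff_fact:
  "sqrt_coeff (Suc j) = - fact (2 * j) / (2 ^ (2 * j) * fact j * fact (Suc j))"
proof (induction j)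
  case 0
  show ?case using sqrt_coeff_Suc[of 0] by simp
next
  case (Suc j)
  have "sqrt_coeff (Suc (Suc j)) = (2 * real j + 1) / (2 * (real j + 2)) * sqrt_coeff (Suc j)"
    using sqrt_coeff_Suc[of "Suc j"] by (simp add: field_simps)
  also have "\<dots> = - fact (2 * Suc j) / (2 ^ (2 * Suc j) * fact (Suc j) * fact (Suc (Suc j)))"
    unfolding Suc.IH by (simp add: divide_simps) (simp add: algebra_simps)
  finally show ?case .
qed

text \<open>Up to the sign (-1)^m, the coefficient of x^(2m+1) in 2 sqrt(1 + x^2) arctan x, as a
  Cauchy product.\<close>

definition H :: "nat \<Rightarrow> real" where
  "H m = (\<Sum>i\<le>m. sqrt_coeff (m - i) / (2 * real i + 1))"

text \<open>The summand i = m of \<open>H m\<close> is 2/(2m+1); with the 1/(2m+1) of the bare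
  arctangent it makes up the 3/(2m+1) in \<open>E m\<close>.\<close>

lemma E_eq_H: "E m = 1 / (2 * real m + 1) + H m"
proof -
  have "(\<Sum>i<m. fact (2 * m - 2 * i - 2) /
        (2 ^ (2 * m - 2 * i - 2) * (2 * real i + 1) * fact (m - i - 1) * fact (m - i)))
      = (\<Sum>i<m. - (sqrt_coeff (m - i) / (2 * real i + 1)))"
  proof (rule sum.cong)
    fix i assume "i \<in> {..<m}"
    then obtain j where "m = Suc (i + j)"
      using less_imp_Suc_add by auto
    then have *: "m - i = Suc j" "m - i - 1 = j" "2 * m - 2 * i - 2 = 2 * j" by auto
    show "fact (2 * m - 2 * i - 2) /
        (2 ^ (2 * m - 2 * i - 2) * (2 * real i + 1) * fact (m - i - 1) * fact (m - i))
        = - (sqrt_coeff (m - i) / (2 * real i + 1))"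
      unfolding * sqrt_coeff_fact by (simp add: mult_ac)
  qed simp
  moreover have "(\<Sum>i\<le>m. sqrt_coeff (m - i) / (2 * real i + 1))
      = (\<Sum>i<m. sqrt_coeff (m - i) / (2 * real i + 1)) + 2 / (2 * real m + 1)"
    by (simp add: lessThan_Suc_atMost[symmetric])
  ultimately show ?thesis
    by (simp add: E_def H_def sum_negf add_divide_distrib[symmetric])
qed

text \<open>Coefficient form of (1 + x^2) g' = x g + sqrt(1 + x^2) for g = sqrt(1 + x^2) arctan x.
  The proof stays with finite sums: 2m + 3 is split as (2i + 1) + 2(m + 1 - i), and the first part
  cancels the denominator.\<close>

lemma H_Suc: "(2 * real m + 3) * H (Suc m) = 2 * real m * H m + sqrt_coeff (Suc m)"
proof -
  let ?d = "\<lambda>i. 2 * real i + 1"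
  have nz: "?d i \<noteq> 0" for i
    by (metis add_nonneg_eq_0_iff mult_nonneg_nonneg of_nat_0_le_iff zero_le_numeral zero_le_one zero_neq_one)
  have "(2 * real m + 3) * H (Suc m)
      = (\<Sum>i\<le>Suc m. sqrt_coeff (Suc m - i) + 2 * real (Suc m - i) * sqrt_coeff (Suc m - i) / ?d i)"
    unfolding H_def sum_distrib_left
  proof (rule sum.cong)
    fix i assume "i \<in> {..Suc m}"
    then have "real (Suc m - i) = real m + 1 - real i" by (simp add: of_nat_diff)
    then show "(2 * real m + 3) * (sqrt_coeff (Suc m - i) / ?d i)
        = sqrt_coeff (Suc m - i) + 2 * real (Suc m - i) * sqrt_coeff (Suc m - i) / ?d i"
      using nz[of i] by (simp add: divide_simps) (simp add: algebra_simps)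
  qed simp
  also have "\<dots> = (\<Sum>i\<le>Suc m. sqrt_coeff (Suc m - i))
      + (\<Sum>i\<le>m. 2 * real (Suc m - i) * sqrt_coeff (Suc m - i) / ?d i)"
    by (simp add: sum.distrib)
  \<comment> \<open>\<open>sqrt_coeff_Suc\<close> at j = m - i, with 2j - 1 = 2m - (2i + 1).\<close>
  also have "(\<Sum>i\<le>m. 2 * real (Suc m - i) * sqrt_coeff (Suc m - i) / ?d i)
      = (\<Sum>i\<le>m. 2 * real m * (sqrt_coeff (m - i) / ?d i) - sqrt_coeff (m - i))"
  proof (rule sum.cong)
    fix i assume "i \<in> {..m}"
    then have "Suc m - i = Suc (m - i)" "real (m - i) = real m - real i"
      by (auto simp: of_nat_diff)
    then show "2 * real (Suc m - i) * sqrt_coeff (Suc m - i) / ?d i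
        = 2 * real m * (sqrt_coeff (m - i) / ?d i) - sqrt_coeff (m - i)"
      using sqrt_coeff_Suc[of "m - i"] nz[of i]
      by (simp add: divide_simps) (simp add: algebra_simps)
  qed simp
  also have "\<dots> = 2 * real m * H m - (\<Sum>i\<le>m. sqrt_coeff (m - i))"
    by (simp add: H_def sum_subtractf sum_distrib_left)
  also have "(\<Sum>i\<le>Suc m. sqrt_coeff (Suc m - i)) = sqrt_coeff (Suc m) + (\<Sum>i\<le>m. sqrt_coeff (m - i))"
    by (subst sum.atMost_Suc_shift) simp
  finally show ?thesis by simp
qed

section \<open>Positivity and monotonicity of E\<close>

text \<open>Equal to -(2m+1) \<open>H m\<close>, so the recurrence for \<open>H\<close> carries
  over.\<close>

definition w :: "nat \<Rightarrow> real" where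
  "w m = 1 - (2 * real m + 1) * E m"

text \<open>In closed form, binomial(2m+1, m) / 4^m.\<close>

definition q :: "nat \<Rightarrow> real" where
  "q m = - (2 * real m + 1) * sqrt_coeff (Suc m)"

lemma q_0 [simp]: "q 0 = 1"
  using sqrt_coeff_Suc[of 0] by (simp add: q_def)

lemma q_Suc: "q (Suc m) = q m * (2 * real m + 3) / (2 * real m + 4)"
  using sqrt_coeff_Suc[of "Suc m"] by (simp add: q_def field_simps)

lemma q_pos: "q m > 0"
  by (induction m) (auto simp: q_Suc)

text \<open>The next value is the mean of \<open>w m\<close> and \<open>q m\<close> with weights 2m
  and 1, so \<open>w\<close> decreases as long as it stays above \<open>q\<close>.\<close>

lemma w_Suc: "w (Suc m) = (2 * real m * w m + q m) / (2 * real m + 1)"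
proof -
  have w: "w m = - (2 * real m + 1) * H m" for m
  proof -
    have "2 * real m + 1 \<noteq> 0" by linarith
    then show ?thesis unfolding w_def E_eq_H by (simp add: distrib_left) (simp add: algebra_simps)
  qed
  have "w (Suc m) = - (2 * real m * H m + sqrt_coeff (Suc m))"
    unfolding w using H_Suc[of m] by (simp add: algebra_simps)
  also have "\<dots> = (2 * real m * w m + q m) / (2 * real m + 1)"
    by (simp add: w[of m] q_def divide_simps) (simp add: algebra_simps)
  finally show ?thesis .
qed

lemma w_1 [simp]: "w (Suc 0) = 1"
  by (simp add: w_Suc)

text \<open>The constant 4/3 gives equality at m = 1. After clearing denominators, the induction
  step comes down to 32m \<le> 38m.\<close>

lemma w_ge: "m \<ge> 1 \<Longrightarrow> w m \<ge> 4 / 3 * q m"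
proof (induction m rule: nat_induct_at_least)
  case base
  show ?case by (simp add: q_Suc)
next
  case (Suc m)
  have "4 / 3 * ((2 * real m + 3) / (2 * real m + 4)) \<le> (2 * real m * (4 / 3) + 1) / (2 * real m + 1)"
    using Suc.hyps by (simp add: field_simps)
  from mult_left_mono[OF this less_imp_le[OF q_pos[of m]]]
  have "4 / 3 * q (Suc m) \<le> q m * ((2 * real m * (4 / 3) + 1) / (2 * real m + 1))"
    unfolding q_Suc by (simp add: mult_ac)
  also have "\<dots> = (2 * real m * (4 / 3 * q m) + q m) / (2 * real m + 1)"
    by (simp add: field_simps)
  also have "\<dots> \<le> w (Suc m)"
    unfolding w_Suc by (intro divide_right_mono add_right_mono mult_left_mono Suc.IH) auto
  finally show ?case .
qed

lemma w_decreasing: "m \<ge> 1 \<Longrightarrow> w (Suc m) < w m"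
  using w_ge[of m] q_pos[of m] by (simp add: w_Suc field_simps)

lemma w_less_1: "m \<ge> 2 \<Longrightarrow> w m < 1"
proof (induction m rule: nat_induct_at_least)
  case base
  show ?case using w_decreasing[of 1] by (simp add: numeral_2_eq_2)
next
  case (Suc m)
  then show ?case using w_decreasing[of m] by simp
qed

lemma E_eq_w: "E m = (1 - w m) / (2 * real m + 1)"
  unfolding w_def by (simp add: field_simps)

lemma E_pos: "m \<ge> 2 \<Longrightarrow> E m > 0"
  using w_less_1[of m] unfolding E_eq_w by simp

text \<open>By \<open>w_Suc\<close> this inequality is equivalent to \<open>E (Suc m) < E m\<close>.
  It fails at m = 3; from m = 4 on it persists because 3w - q does not increase.\<close>

lemma three_w_less: "m \<ge> 4 \<Longrightarrow> 3 * w m - q m < 2"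
proof (induction m rule: nat_induct_at_least)
  case base
  show ?case by (simp add: w_Suc q_Suc eval_nat_numeral)
next
  case (Suc m)
  \<comment> \<open>The left side is the increment of 3w - q. The bound \<open>w_ge\<close> says
    exactly that 3(w - q) \<ge> q.\<close>
  have "3 * (q m - w m) / (2 * real m + 1) + q m / (2 * real m + 4)
      \<le> - q m / (2 * real m + 1) + q m / (2 * real m + 4)"
    using w_ge[of m] Suc.hyps by (intro add_right_mono divide_right_mono) auto
  also have "\<dots> \<le> 0"
    using q_pos[of m] by (simp add: field_simps)
  finally have "3 * (q m - w m) / (2 * real m + 1) + q m / (2 * real m + 4) \<le> 0" .
  moreover have "w (Suc m) = w m + (q m - w m) / (2 * real m + 1)"
    by (simp add: w_Suc field_simps)
  moreover have "q (Suc m) = q m - q m / (2 * real m + 4)"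
    by (simp add: q_Suc field_simps)
  ultimately show ?case using Suc.IH by (simp add: algebra_simps)
qed

lemma E_decreasing: "m \<ge> 4 \<Longrightarrow> E (Suc m) < E m"
proof -
  assume "m \<ge> 4"
  have "(2 * real m + 1) * w (Suc m) = 2 * real m * w m + q m"
    by (simp add: w_Suc field_simps)
  then have "(1 - w (Suc m)) * (2 * real m + 1) < (1 - w m) * (2 * real m + 3)"
    using three_w_less[OF \<open>m \<ge> 4\<close>] by (simp add: algebra_simps)
  then show ?thesis by (simp add: E_eq_w field_simps)
qed

lemma E_values:
  "E 0 = 3" "E 1 = 0" "E 3 = 17 / 840" "E 4 = 139 / 6720" "E 5 = 8947 / 443520" "E 6 = 89279 / 4612608"
  \<comment> \<open>The recurrence only yields \<open>w\<close> from index 1 on, so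
    \<open>E 0\<close> is read off the empty sum in \<open>E_def\<close>.\<close>
  by (simp add: E_def) (simp_all add: E_eq_w w_Suc q_Suc eval_nat_numeral)

section \<open>Taylor expansion of the scaled arctangent\<close>

definition partial :: "nat \<Rightarrow> real \<Rightarrow> real" where
  "partial n x = (\<Sum>m\<le>n. (-1) ^ m * E m * x ^ (2 * m + 1))"

definition scaled_arctan :: "real \<Rightarrow> real" where
  "scaled_arctan x = (1 + 2 * sqrt (1 + x\<^sup>2)) * arctan x"

lemma partial_eq:
  assumes "n \<ge> 1"
  shows "partial n x = 3 * x + (\<Sum>m=2..n. (-1) ^ m * E m * x ^ (2 * m + 1))"
proof -
  have "{..n} = insert 0 (insert 1 {2..n})" using assms by auto
  then show ?thesis using E_values by (simp add: partial_def)
qed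

lemma arctan_sums:
  assumes "\<bar>x\<bar> < 1"
  shows "(\<lambda>i. (-1) ^ i * x ^ (2 * i + 1) / (2 * real i + 1)) sums arctan x"
    and "summable (\<lambda>i. norm ((-1) ^ i * x ^ (2 * i + 1) / (2 * real i + 1)))"
proof -
  have "summable (\<lambda>i. (-1) ^ i * (1 / real (i * 2 + 1) * x ^ (i * 2 + 1)))"
    using summable_arctan_series[of x] assms by simp
  then show "(\<lambda>i. (-1) ^ i * x ^ (2 * i + 1) / (2 * real i + 1)) sums arctan x"
    using arctan_series[of x] assms by (simp add: sums_iff mult_ac add.commute)
  have "summable (\<lambda>i. (x\<^sup>2) ^ i)"
    using assms by (intro summable_geometric) (simp add: abs_square_less_1)
  moreover have "norm (norm ((-1) ^ i * x ^ (2 * i + 1) / (2 * real i + 1))) \<le> (x\<^sup>2) ^ i" for i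
  proof -
    have "\<bar>x\<bar> * (x\<^sup>2) ^ i \<le> (1 + 2 * real i) * (x\<^sup>2) ^ i"
      using assms by (intro mult_right_mono) auto
    moreover have "norm ((-1) ^ i * x ^ (2 * i + 1) / (2 * real i + 1))
        = \<bar>x\<bar> * (x\<^sup>2) ^ i / (1 + 2 * real i)"
      by (simp add: abs_mult power_mult power_abs[symmetric] add.commute del: power_abs)
    ultimately show ?thesis by (simp add: divide_le_eq mult.commute)
  qed
  ultimately show "summable (\<lambda>i. norm ((-1) ^ i * x ^ (2 * i + 1) / (2 * real i + 1)))"
    by (rule summable_comparison_test')
qed

lemma sqrt_sums:
  assumes "\<bar>x\<bar> < 1"
  shows "(\<lambda>j. (-1) ^ j * sqrt_coeff j * x ^ (2 * j)) sums (2 * sqrt (1 + x\<^sup>2))"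
    and "summable (\<lambda>j. norm ((-1) ^ j * sqrt_coeff j * x ^ (2 * j)))"
proof -
  have eq: "(-1) ^ j * sqrt_coeff j * y ^ (2 * j) = 2 * (((1/2) gchoose j) * (y\<^sup>2) ^ j)" for j y
    by (simp add: sqrt_coeff_def power_mult mult.assoc[symmetric] power_mult_distrib[symmetric])
  have sums: "(\<lambda>j. ((1/2) gchoose j) * (y\<^sup>2) ^ j) sums sqrt (1 + y\<^sup>2)" if "\<bar>y\<bar> < 1" for y :: real
    using gen_binomial_real[of "y\<^sup>2" "1/2"] that
    by (simp add: abs_square_less_1 powr_half_sqrt add_nonneg_nonneg)
  show "(\<lambda>j. (-1) ^ j * sqrt_coeff j * x ^ (2 * j)) sums (2 * sqrt (1 + x\<^sup>2))"
    unfolding eq by (intro sums_mult sums assms)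
  \<comment> \<open>Convergence of the binomial series at the larger point y^2 gives absolute
    convergence at x^2, as the Cauchy product requires.\<close>
  obtain y where y: "\<bar>x\<bar> < y" "y < 1" using assms dense by blast
  then have "norm (x\<^sup>2) < norm (y\<^sup>2)"
    by (metis abs_ge_zero abs_power2 power2_abs power_strict_mono real_norm_def zero_less_numeral)
  then show "summable (\<lambda>j. norm ((-1) ^ j * sqrt_coeff j * x ^ (2 * j)))"
    unfolding eq using powser_insidea[OF sums_summable[OF sums[of y]], of "x\<^sup>2"] y
    by (simp add: abs_mult summable_mult)
qed

lemma partial_tendsto:
  assumes "\<bar>x\<bar> < 1"
  shows "(\<lambda>n. partial n x) \<longlonglongrightarrow> scaled_arctan x"
proof -
  let ?a = "\<lambda>i. (-1) ^ i * x ^ (2 * i + 1) / (2 * real i + 1)"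
  let ?b = "\<lambda>j. (-1) ^ j * sqrt_coeff j * x ^ (2 * j)"
  have "(\<lambda>m. \<Sum>i\<le>m. ?a i * ?b (m - i)) sums ((\<Sum>i. ?a i) * (\<Sum>j. ?b j))"
    by (rule Cauchy_product_sums[OF arctan_sums(2)[OF assms] sqrt_sums(2)[OF assms]])
  then have "(\<lambda>m. ?a m + (\<Sum>i\<le>m. ?a i * ?b (m - i))) sums
      (arctan x + arctan x * (2 * sqrt (1 + x\<^sup>2)))"
    using arctan_sums(1)[OF assms] sqrt_sums(1)[OF assms]
    by (intro sums_add) (simp_all add: sums_iff)
  moreover have "?a m + (\<Sum>i\<le>m. ?a i * ?b (m - i)) = (-1) ^ m * E m * x ^ (2 * m + 1)" for m
  proof -
    have "?a i * ?b (m - i) = (-1) ^ m * x ^ (2 * m + 1) * (sqrt_coeff (m - i) / (2 * real i + 1))"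
      if im: "i \<le> m" for i
    proof -
      from le_Suc_ex[OF im] obtain j where "m = i + j" ..
      then have eq: "(-1) ^ m = (-1) ^ i * (-1::real) ^ j" "m - i = j"
        "x ^ (2 * m + 1) = x ^ (2 * i + 1) * x ^ (2 * j)"
        by (simp_all add: power_add distrib_left)
      show ?thesis unfolding eq by (simp only: times_divide_eq_left times_divide_eq_right mult_ac)
    qed
    then have "(\<Sum>i\<le>m. ?a i * ?b (m - i))
        = (-1) ^ m * x ^ (2 * m + 1) * H m"
      unfolding H_def sum_distrib_left by (intro sum.cong) auto
    then show ?thesis unfolding E_eq_H
      by (simp only: distrib_left distrib_right) (simp add: mult_ac)
  qed
  ultimately have "(\<lambda>m. (-1) ^ m * E m * x ^ (2 * m + 1)) sums
      (arctan x + arctan x * (2 * sqrt (1 + x\<^sup>2)))"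
    by (simp only:)
  moreover have "arctan x + arctan x * (2 * sqrt (1 + x\<^sup>2)) = scaled_arctan x"
    by (simp add: scaled_arctan_def distrib_right)
  ultimately show ?thesis
    by (simp only: sums_def_le partial_def)
qed

section \<open>Leibniz bounds from the partial sums\<close>

lemma term_decreasing:
  assumes "m \<ge> 4" "0 < x" "x \<le> 1"
  shows "E (Suc m) * x ^ (2 * Suc m + 1) < E m * x ^ (2 * m + 1)"
proof -
  have "E (Suc m) * x ^ (2 * Suc m + 1) \<le> E (Suc m) * x ^ (2 * m + 1)"
    using assms E_pos[of "Suc m"] by (intro mult_left_mono power_decreasing) auto
  also have "\<dots> < E m * x ^ (2 * m + 1)"
    using assms E_decreasing[of m] by (intro mult_strict_right_mono) auto
  finally show ?thesis .
qed

text \<open>The two added terms have indices 2n+1 and 2n+2. For n = 1 they would be 3 and 4, where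
  \<open>E\<close> increases.\<close>

lemma partial_even_decreasing:
  assumes "n \<ge> 2" "0 < x" "x \<le> 1"
  shows "partial (2 * Suc n) x < partial (2 * n) x"
  using term_decreasing[of "2 * n + 1" x] assms by (simp add: partial_def)

lemma partial_odd_increasing:
  assumes "n \<ge> 1" "0 < x" "x \<le> 1"
  shows "partial (2 * n + 1) x < partial (2 * Suc n + 1) x"
  using term_decreasing[of "2 * n + 2" x] assms by (simp add: partial_def)

lemma continuous_on_scaled_arctan: "continuous_on S scaled_arctan"
  unfolding scaled_arctan_def by (intro continuous_intros)

lemma continuous_on_partial: "continuous_on S (partial n)"
  unfolding partial_def by (intro continuous_intros)

text \<open>Carries weak inequalities to x = 1, which the series argument on |x| < 1 does not cover;
  strictness is recovered at the very end.\<close>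

lemma nonneg_of_nonneg_interior:
  fixes f :: "real \<Rightarrow> real"
  assumes "continuous_on {0..1} f" "\<And>y. 0 < y \<Longrightarrow> y < 1 \<Longrightarrow> f y \<ge> 0" "0 < x" "x \<le> 1"
  shows "f x \<ge> 0"
proof -
  have "closure {0<..<1::real} = {0..1}" by (simp add: closure_greaterThanLessThan)
  then show ?thesis
    using assms continuous_ge_on_closure[of "{0<..<1::real}" f x 0] by auto
qed

lemma scaled_arctan_le_partial_even:
  assumes "n \<ge> 2" "0 < x" "x \<le> 1"
  shows "scaled_arctan x \<le> partial (2 * n) x"
proof -
  have "partial (2 * n) y - scaled_arctan y \<ge> 0" if "0 < y" "y < 1" for y
  proof -
    have "decseq (\<lambda>j. partial (2 * (n + j)) y)"
      using partial_even_decreasing[of "n + _" y] that assms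
      by (intro decseq_SucI) (simp add: less_imp_le)
    moreover have "(\<lambda>j. partial (2 * (n + j)) y) \<longlonglongrightarrow> scaled_arctan y"
      using LIMSEQ_subseq_LIMSEQ[OF partial_tendsto[of y], of "\<lambda>j. 2 * (n + j)"] that
      by (simp add: o_def strict_mono_def)
    ultimately show ?thesis
      using decseq_ge[of _ "scaled_arctan y" 0] by fastforce
  qed
  then show ?thesis
    using nonneg_of_nonneg_interior[of "\<lambda>y. partial (2 * n) y - scaled_arctan y" x] assms
    by (simp add: continuous_on_diff continuous_on_scaled_arctan continuous_on_partial)
qed

lemma partial_odd_le_scaled_arctan:
  assumes "n \<ge> 1" "0 < x" "x \<le> 1"
  shows "partial (2 * n + 1) x \<le> scaled_arctan x"
proof -
  have "scaled_arctan y - partial (2 * n + 1) y \<ge> 0" if "0 < y" "y < 1" for y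
  proof -
    have "incseq (\<lambda>j. partial (2 * (n + j) + 1) y)"
      using partial_odd_increasing[of "n + _" y] that assms
      by (intro incseq_SucI) (simp add: less_imp_le)
    moreover have "(\<lambda>j. partial (2 * (n + j) + 1) y) \<longlonglongrightarrow> scaled_arctan y"
      using LIMSEQ_subseq_LIMSEQ[OF partial_tendsto[of y], of "\<lambda>j. 2 * (n + j) + 1"] that
      by (simp add: o_def strict_mono_def)
    ultimately show ?thesis
      using incseq_le[of _ "scaled_arctan y" 0] by fastforce
  qed
  then show ?thesis
    using nonneg_of_nonneg_interior[of "\<lambda>y. scaled_arctan y - partial (2 * n + 1) y" x] assms
    by (simp add: continuous_on_diff continuous_on_scaled_arctan continuous_on_partial)
qed

text \<open>Since \<open>E 3 < E 4\<close>, pairing terms fails near x = 1. With t = x^2 the four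
  terms are x^7 times a cubic in t, and bounding t^3 by t^2 in its last term leaves the quadratic
  \<open>E 3 - E 4 * t + d * t ^ 2\<close>.\<close>

lemma partial_6_less_partial_2:
  assumes "0 < x" "x \<le> 1"
  shows "partial 6 x < partial 2 x"
proof -
  define t where "t = x\<^sup>2"
  have t: "0 < t" "t \<le> 1" using assms by (auto simp: t_def power_le_one)
  define d where "d = E 5 - E 6"
  have d: "0 < d" "E 4 - 2 * d > 0" "E 3 - E 4 + d > 0" by (simp_all add: d_def E_values)
  \<comment> \<open>The quadratic is split into its value at t = 1 and a multiple of 1 - t.\<close>
  have "0 < (1 - t) * (E 4 - d - d * t) + (E 3 - E 4 + d)"
  proof (rule add_nonneg_pos)
    have "0 \<le> E 4 - d - d * t"
      using d t mult_left_le[of t d] by linarith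
    then show "0 \<le> (1 - t) * (E 4 - d - d * t)"
      using t by simp
  qed (rule d)
  also have "\<dots> = E 3 - E 4 * t + E 5 * t ^ 2 - E 6 * t ^ 2"
    by (simp add: d_def algebra_simps power2_eq_square)
  also have "\<dots> \<le> E 3 - E 4 * t + E 5 * t ^ 2 - E 6 * t ^ 3"
    using t E_pos[of 6] by (intro diff_left_mono mult_left_mono power_decreasing) auto
  finally have "0 < x ^ 7 * (E 3 - E 4 * t + E 5 * t ^ 2 - E 6 * t ^ 3)"
    using assms by simp
  moreover have "partial 2 x - partial 6 x = E 3 * x ^ 7 - E 4 * x ^ 9 + E 5 * x ^ 11 - E 6 * x ^ 13"
    by (simp add: partial_def eval_nat_numeral)
  moreover have "\<dots> = x ^ 7 * (E 3 - E 4 * t + E 5 * t ^ 2 - E 6 * t ^ 3)"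
    by (simp add: t_def algebra_simps power_mult[symmetric] power_add[symmetric])
  ultimately show ?thesis by linarith
qed

theorem theorem2:
  fixes x :: real and k :: nat
  assumes "0 < x" and "x \<le> 1" and "k \<ge> 1"
  shows "(3 * x + (\<Sum>m=2..2*k+1. (-1) ^ m * E m * x ^ (2 * m + 1))) / (1 + 2 * sqrt (1 + x\<^sup>2))
           < arctan x
       \<and> arctan x
           < (3 * x + (\<Sum>m=2..2*k. (-1) ^ m * E m * x ^ (2 * m + 1))) / (1 + 2 * sqrt (1 + x\<^sup>2))"
proof -
  have "1 + 2 * sqrt (1 + x\<^sup>2) > 0"
    by (simp add: add_pos_nonneg)
  \<comment> \<open>One strict step to the next odd partial sum makes the weak bound strict.\<close>
  moreover have "partial (2 * k + 1) x < scaled_arctan x"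
    using partial_odd_increasing[of k x] partial_odd_le_scaled_arctan[of "Suc k" x] assms by linarith
  moreover have "scaled_arctan x < partial (2 * k) x"
  \<comment> \<open>At x = 1 \<open>partial 4\<close> exceeds \<open>partial 2\<close>, so for k = 1
    the comparison jumps to \<open>partial 6\<close>.\<close>
  proof (cases "k = 1")
    case True
    then show ?thesis
      using partial_6_less_partial_2[of x] scaled_arctan_le_partial_even[of 3 x] assms by simp
  next
    case False
    then show ?thesis
      using partial_even_decreasing[of k x] scaled_arctan_le_partial_even[of "Suc k" x] assms by linarith
  qed
  ultimately show ?thesis
    using partial_eq[of "2 * k + 1" x] partial_eq[of "2 * k" x] \<open>k \<ge> 1\<close>
    by (simp add: scaled_arctan_def divide_less_eq less_divide_eq mult.commute)
qed

end
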